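(* Let $F:\Delta\to\mathbb R^n$ be smooth. For $(\sigma,\mu)\in\Delta\times\{\mu\in\mathbb R^n:\mu>0\}$, the following statements are equivalent. (i) $(\sigma,\mu)$ satisfies the fixed-point KKT system for some $r\in\mathbb R^n$, $v\in\mathbb R$; that is, with $\hat\sigma=\sigma$, $$\hat\sigma\circ r-\mu=0,\qquad r-F(\sigma)-v\mathbf 1=0,\qquad\mathbf 1^\top\hat\sigma-1=0 .$$ (ii) $\sigma$ is a fixed point, $\sigma=\hat\sigma$, of the Brouwer function $(\hat\sigma,r,v)=M(\sigma,\mu)$. (iii) $(\sigma,\mu)$ satisfies $\check\sigma=\sigma$ and the perturbed KKT conditions of the mixed complementarity problem for some $r,\bar\lambda,\check\sigma,\check r\in\mathbb R^n$ and $v,\tilde\lambda\in\mathbb R$; that is, $$\begin{aligned}&-\left(\partial F(\sigma)/\partial\sigma\right)^\top\bar\lambda+\tilde\lambda\mathbf 1+r-\check r=0,\quad \bar\lambda+\sigma-\check\sigma=0,\quad -\bar\lambda^\top\mathbf 1=0,\\ & r\circ\check\sigma-\mu=0,\quad \sigma\circ\check r-\mu=0,\quad r-F(\sigma)-v\mathbf 1=0,\quad \mathbf 1^\top\sigma-1=0 .\end{aligned}$$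
   Context: $\Delta=\{\sigma\in\mathbb R^n:\sigma\ge0,\ \mathbf 1^\top\sigma=1\}$, $\mathbf 1$ is the all-ones vector, $\circ$ is the componentwise product and vector inequalities are componentwise. $F$ smooth on $\Delta$ means it extends smoothly to a neighborhood of $\Delta$; $\partial F(\sigma)/\partial\sigma$ is its Jacobian. Brouwer function: for $(\sigma,\mu)\in\Delta\times\{\mu>0\}$, $M(\sigma,\mu)=(\hat\sigma,r,v)$ is the (unique) triple with $\hat\sigma\in\Delta$, $r\in\mathbb R^n$, $v\in\mathbb R$ satisfying $\hat\sigma\circ r=\mu$, $r=F(\sigma)+v\mathbf 1$, $\mathbf 1^\top\hat\sigma=1$. The mixed complementarity problem (with barrier) is $\min_{(\sigma,r,v)}\ \sigma^\top r-\mu^\top\ln\sigma-\mu^\top\ln r$ subject to $r=F(\sigma)+v\mathbf 1$, $\mathbf 1^\top\sigma=1$, $(\sigma,r)\ge0$; $\bar\lambda,\tilde\lambda,\check\sigma,\check r$ are the Lagrange multipliers, and its perturbed KKT conditions are the system displayed in (iii). *)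

theory Defs
  imports "HOL-Analysis.Analysis"
begin

text \<open>
  On the type \<open>real ^ 'n\<close> the library's \<open>1\<close> is the all-ones vector and \<open>*\<close> is the
  componentwise product.  Its strict order \<open><\<close> is not the componentwise one, so
  componentwise inequalities are spelled out below.
\<close>

definition simplex_Delta :: "(real ^ 'n::finite) set" where
  "simplex_Delta = {\<sigma>. (\<forall>i. 0 \<le> \<sigma> $ i) \<and> 1 \<bullet> \<sigma> = 1}"

text \<open>
  Continuous differentiability of order \<open>k\<close> on an open set: all iterated directional
  derivatives up to order \<open>k\<close> exist as Frechet derivatives and are continuous.
\<close>

fun Ck_on :: "nat \<Rightarrow> 'a::euclidean_space set \<Rightarrow> ('a \<Rightarrow> 'b::real_normed_vector) \<Rightarrow> bool" where
  "Ck_on 0 U f \<longleftrightarrow> continuous_on U f"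
| "Ck_on (Suc k) U f \<longleftrightarrow>
     (\<forall>x\<in>U. f differentiable (at x)) \<and>
     (\<forall>h. Ck_on k U (\<lambda>x. frechet_derivative f (at x) h))"

definition smooth_on :: "'a::euclidean_space set \<Rightarrow> ('a \<Rightarrow> 'b::real_normed_vector) \<Rightarrow> bool" where
  "smooth_on U f \<longleftrightarrow> (\<forall>k. Ck_on k U f)"

text \<open>
  \<open>F\<close> is smooth on \<open>S\<close>, as witnessed by the extension \<open>G\<close>.  The extension is kept explicit
  because the Jacobian of \<open>F\<close> at a point of the simplex is that of an extension.
\<close>

definition smooth_extension ::
    "'a::euclidean_space set \<Rightarrow> ('a \<Rightarrow> 'b::real_normed_vector) \<Rightarrow> ('a \<Rightarrow> 'b) \<Rightarrow> bool" where
  "smooth_extension S F G \<longleftrightarrow>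
     (\<exists>U. open U \<and> S \<subseteq> U \<and> smooth_on U G) \<and> (\<forall>x\<in>S. G x = F x)"

definition fixed_point_kkt ::
    "(real ^ 'n \<Rightarrow> real ^ 'n) \<Rightarrow> real ^ 'n \<Rightarrow> real ^ 'n \<Rightarrow> real ^ 'n \<Rightarrow> real ^ 'n \<Rightarrow> real \<Rightarrow> bool" where
  "fixed_point_kkt F \<sigma> \<mu> \<sigma>hat r v \<longleftrightarrow>
     \<sigma>hat * r - \<mu> = 0 \<and>
     r - F \<sigma> - v *\<^sub>R 1 = 0 \<and>
     1 \<bullet> \<sigma>hat - 1 = 0"

text \<open>
  The triple is unique for \<open>\<sigma>\<close> in the simplex and componentwise positive \<open>\<mu>\<close>; the
  value is irrelevant for other arguments.
\<close>

definition brouwer_function ::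
    "(real ^ 'n::finite \<Rightarrow> real ^ 'n) \<Rightarrow> real ^ 'n \<Rightarrow> real ^ 'n \<Rightarrow> (real ^ 'n) \<times> (real ^ 'n) \<times> real" where
  "brouwer_function F \<sigma> \<mu> =
     (THE t. case t of (\<sigma>hat, r, v) \<Rightarrow>
        \<sigma>hat \<in> simplex_Delta \<and> fixed_point_kkt F \<sigma> \<mu> \<sigma>hat r v)"

text \<open>
  Perturbed KKT conditions of the barrier problem
  \<open>min \<sigma> \<bullet> r - \<mu> \<bullet> ln \<sigma> - \<mu> \<bullet> ln r\<close> subject to \<open>r = F \<sigma> + v 1\<close>, \<open>1 \<bullet> \<sigma> = 1\<close>.
  The first three equations are stationarity in \<open>\<sigma>\<close>, \<open>r\<close> and \<open>v\<close>, where \<open>lbar\<close> and \<open>ltilde\<close>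
  are the multipliers of the two equality constraints, and \<open>\<sigma>chk = \<mu> / r\<close> and
  \<open>rchk = \<mu> / \<sigma>\<close> come from the barrier terms.  \<open>J\<close> is the Jacobian of \<open>F\<close> at \<open>\<sigma>\<close>.
\<close>

definition mcp_perturbed_kkt ::
    "(real ^ 'n \<Rightarrow> real ^ 'n) \<Rightarrow> real ^ 'n ^ 'n \<Rightarrow> real ^ 'n \<Rightarrow> real ^ 'n \<Rightarrow>
     real ^ 'n \<Rightarrow> real \<Rightarrow> real ^ 'n \<Rightarrow> real ^ 'n \<Rightarrow> real ^ 'n \<Rightarrow> real \<Rightarrow> bool" where
  "mcp_perturbed_kkt F J \<sigma> \<mu> r v lbar \<sigma>chk rchk ltilde \<longleftrightarrow>
     - (transpose J *v lbar) + ltilde *\<^sub>R 1 + r - rchk = 0 \<and>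
     lbar + \<sigma> - \<sigma>chk = 0 \<and>
     - (lbar \<bullet> 1) = 0 \<and>
     r * \<sigma>chk - \<mu> = 0 \<and>
     \<sigma> * rchk - \<mu> = 0 \<and>
     r - F \<sigma> - v *\<^sub>R 1 = 0 \<and>
     1 \<bullet> \<sigma> - 1 = 0"

end

theory Submission
  imports Defs
begin

text \<open>
  The Brouwer function is well defined: the equations force \<open>\<sigma>hat = \<mu> / (F \<sigma> + v)\<close> with positive
  denominators, and \<open>v\<close> is the unique number for which these entries sum to \<open>1\<close>, because the sum
  is strictly decreasing in \<open>v\<close> and takes values on both sides of \<open>1\<close>.  Hence (i) and (ii) agree.
  In (iii), \<open>\<sigma>chk = \<sigma>\<close> forces \<open>lbar = 0\<close>, which removes the Jacobian; conversely
  \<open>lbar = 0\<close>, \<open>ltilde = 0\<close>, \<open>rchk = r\<close> solves the extra equations.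
\<close>

text \<open>Existence is the intermediate value theorem between the explicit shifts
  \<open>w k - m\<close> and \<open>W - m\<close>, where \<open>k\<close> attains the minimum
  \<open>m\<close> of \<open>a\<close> and \<open>W\<close> is the total of
  \<open>w\<close>.\<close>

lemma ex1_normalizing_shift:
  fixes w a :: "'i::finite \<Rightarrow> real"
  assumes w: "\<And>i. 0 < w i"
  shows "\<exists>!v. (\<forall>i. 0 < a i + v) \<and> (\<Sum>i\<in>UNIV. w i / (a i + v)) = 1"
proof -
  let ?S = "\<lambda>v. \<Sum>i\<in>UNIV. w i / (a i + v)"
  define m where "m = Min (range a)"
  have m_le: "m \<le> a i" for i by (simp add: m_def)
  have "m \<in> range a" unfolding m_def by (rule Min_in) auto
  then obtain k where k: "a k = m" by auto
  define W where "W = sum w UNIV"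
  have wW: "w k \<le> W" unfolding W_def
    by (rule member_le_sum) (auto intro: less_imp_le w)
  have pos: "0 < a i + v" if "w k - m \<le> v" for i v
    using that w[of k] m_le[of i] by linarith
  \<comment> \<open>At this shift the denominator of index \<open>k\<close> is \<open>w k\<close>,
    so that term alone contributes 1.\<close>
  have lower: "1 \<le> ?S (w k - m)"
  proof -
    have "1 = w k / (a k + (w k - m))" using w[of k] by (simp add: k)
    also have "\<dots> \<le> ?S (w k - m)"
      by (rule member_le_sum) (auto intro!: divide_nonneg_pos less_imp_le[OF w] pos)
    finally show ?thesis .
  qed
  have W_pos: "0 < W" using w[of k] wW by linarith
  \<comment> \<open>At this shift every denominator is at least \<open>W\<close>.\<close>
  have upper: "?S (W - m) \<le> 1"
  proof -
    have "?S (W - m) \<le> (\<Sum>i\<in>UNIV. w i / W)"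
    proof (rule sum_mono)
      fix i
      show "w i / (a i + (W - m)) \<le> w i / W"
        using m_le[of i] w[of i] W_pos by (intro divide_left_mono) auto
    qed
    also have "\<dots> = 1" using W_pos by (simp add: sum_divide_distrib[symmetric] W_def)
    finally show ?thesis .
  qed
  have "continuous_on {w k - m..W - m} ?S"
    using pos by (intro continuous_intros) (auto simp: less_imp_neq[symmetric])
  then obtain v where v: "w k - m \<le> v" "?S v = 1"
    using IVT2'[of ?S "W - m" 1 "w k - m"] lower upper wW by auto
  \<comment> \<open>Stated for any shift with positive denominators, since a competing solution may
    lie outside the interval above.\<close>
  have strict: "?S y < ?S x" if "x < y" "\<And>i. 0 < a i + x" for x y
  proof (rule sum_strict_mono)
    fix i
    show "w i / (a i + y) < w i / (a i + x)"
      using that(1) that(2)[of i] w[of i] by (intro divide_strict_left_mono) auto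
  qed auto
  show ?thesis
  proof (rule ex1I[of _ v])
    show "(\<forall>i. 0 < a i + v) \<and> ?S v = 1" using v pos by blast
  next
    fix y assume y: "(\<forall>i. 0 < a i + y) \<and> ?S y = 1"
    show "y = v"
      using strict[of y v] strict[of v y] y v pos by (metis less_irrefl linorder_neqE)
  qed
qed

text \<open>Eliminates \<open>r\<close> and \<open>\<sigma>hat\<close> in favour of
  \<open>v\<close>, which leaves one scalar equation.\<close>

lemma fixed_point_kkt_simplex_iff:
  fixes F :: "real ^ 'n \<Rightarrow> real ^ 'n"
  assumes \<mu>: "\<forall>i. 0 < \<mu> $ i"
  shows "\<sigma>hat \<in> simplex_Delta \<and> fixed_point_kkt F \<sigma> \<mu> \<sigma>hat r v \<longleftrightarrow>
    (\<forall>i. 0 < F \<sigma> $ i + v) \<and> (\<Sum>i\<in>UNIV. \<mu> $ i / (F \<sigma> $ i + v)) = 1 \<and>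
    r = F \<sigma> + v *\<^sub>R 1 \<and> \<sigma>hat = (\<chi> i. \<mu> $ i / (F \<sigma> $ i + v))"
    (is "?L \<longleftrightarrow> ?R")
proof
  assume L: ?L
  then have r: "r = F \<sigma> + v *\<^sub>R 1" and prod: "\<sigma>hat * r = \<mu>" and sum: "1 \<bullet> \<sigma>hat = 1"
    and nonneg: "\<And>i. 0 \<le> \<sigma>hat $ i"
    by (auto simp: fixed_point_kkt_def simplex_Delta_def algebra_simps)
  have prod': "\<sigma>hat $ i * (F \<sigma> $ i + v) = \<mu> $ i" for i
    using arg_cong[OF prod, of "\<lambda>x. x $ i"] by (simp add: r)
  \<comment> \<open>The product is positive and its factor \<open>\<sigma>hat $ i\<close> is
    nonnegative, so both factors are positive.\<close>
  have pos: "0 < F \<sigma> $ i + v" for i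
    using prod'[of i] \<mu> nonneg[of i] by (metis zero_less_mult_pos mult_eq_0_iff less_irrefl order_le_less)
  have "\<sigma>hat $ i = \<mu> $ i / (F \<sigma> $ i + v)" for i
    using prod'[of i] pos[of i] by (simp add: field_simps)
  then show ?R using pos r sum by (auto simp: vec_eq_iff inner_vec_def)
next
  assume R: ?R
  then have pos: "\<And>i. 0 < F \<sigma> $ i + v" by blast
  have "\<mu> $ i / (F \<sigma> $ i + v) * (F \<sigma> $ i + v) = \<mu> $ i" for i
    using pos[of i] by simp
  then show ?L using R \<mu>
    by (auto simp: fixed_point_kkt_def simplex_Delta_def vec_eq_iff inner_vec_def
        intro!: divide_nonneg_pos less_imp_le)
qed

text \<open>Replaces the definite description by its defining property; uniqueness of the triple
  comes from that of \<open>v\<close>, which determines \<open>r\<close> and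
  \<open>\<sigma>hat\<close>.\<close>

lemma brouwer_function_eq_iff:
  fixes F :: "real ^ 'n \<Rightarrow> real ^ 'n"
  assumes \<mu>: "\<forall>i. 0 < \<mu> $ i"
  shows "(\<sigma>hat, r, v) = brouwer_function F \<sigma> \<mu> \<longleftrightarrow>
    \<sigma>hat \<in> simplex_Delta \<and> fixed_point_kkt F \<sigma> \<mu> \<sigma>hat r v"
proof -
  let ?P = "\<lambda>(\<sigma>hat, r, v). \<sigma>hat \<in> simplex_Delta \<and> fixed_point_kkt F \<sigma> \<mu> \<sigma>hat r v"
  have "\<exists>!v. (\<forall>i. 0 < F \<sigma> $ i + v) \<and> (\<Sum>i\<in>UNIV. \<mu> $ i / (F \<sigma> $ i + v)) = 1"
    using \<mu> by (intro ex1_normalizing_shift) auto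
  then have "\<exists>!t. ?P t"
    unfolding fixed_point_kkt_simplex_iff[OF \<mu>] by (simp add: Ex1_def) blast
  then show ?thesis
    unfolding brouwer_function_def using theI'[of ?P] the1_equality[of ?P "(\<sigma>hat, r, v)"] by auto
qed

text \<open>Both sides share \<open>r\<close> and \<open>v\<close>, so the equivalence can be
  rewritten under their quantifiers.\<close>

lemma mcp_perturbed_kkt_self_iff:
  fixes F :: "real ^ 'n \<Rightarrow> real ^ 'n"
  shows "(\<exists>lbar rchk ltilde. mcp_perturbed_kkt F J \<sigma> \<mu> r v lbar \<sigma> rchk ltilde)
    \<longleftrightarrow> fixed_point_kkt F \<sigma> \<mu> \<sigma> r v"
proof
  assume "fixed_point_kkt F \<sigma> \<mu> \<sigma> r v"
  \<comment> \<open>With zero multipliers, stationarity in \<open>\<sigma>\<close> reads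
    \<open>r - rchk = 0\<close>.\<close>
  then have "mcp_perturbed_kkt F J \<sigma> \<mu> r v 0 \<sigma> r 0"
    by (auto simp: mcp_perturbed_kkt_def fixed_point_kkt_def mult.commute)
  then show "\<exists>lbar rchk ltilde. mcp_perturbed_kkt F J \<sigma> \<mu> r v lbar \<sigma> rchk ltilde" by blast
next
  assume "\<exists>lbar rchk ltilde. mcp_perturbed_kkt F J \<sigma> \<mu> r v lbar \<sigma> rchk ltilde"
  then have "r * \<sigma> - \<mu> = 0" "r - F \<sigma> - v *\<^sub>R 1 = 0" "1 \<bullet> \<sigma> - 1 = 0"
    unfolding mcp_perturbed_kkt_def by blast+
  then show "fixed_point_kkt F \<sigma> \<mu> \<sigma> r v"
    by (simp only: fixed_point_kkt_def mult.commute[of \<sigma> r] simp_thms)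
qed

theorem theorem5:
  fixes F G :: "real ^ 'n \<Rightarrow> real ^ 'n"
    and \<sigma> \<mu> :: "real ^ 'n"
  assumes "smooth_extension simplex_Delta F G"
    and "\<sigma> \<in> simplex_Delta"
    and "\<forall>i. 0 < \<mu> $ i"
  shows "((\<exists>r v. fixed_point_kkt F \<sigma> \<mu> \<sigma> r v)
           \<longleftrightarrow> (\<exists>\<sigma>hat r v. (\<sigma>hat, r, v) = brouwer_function F \<sigma> \<mu> \<and> \<sigma> = \<sigma>hat))
       \<and> ((\<exists>\<sigma>hat r v. (\<sigma>hat, r, v) = brouwer_function F \<sigma> \<mu> \<and> \<sigma> = \<sigma>hat)
           \<longleftrightarrow> (\<exists>r lbar \<sigma>chk rchk v ltilde.
                 \<sigma>chk = \<sigma> \<and>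
                 mcp_perturbed_kkt F (jacobian G (at \<sigma>)) \<sigma> \<mu> r v lbar \<sigma>chk rchk ltilde))"
proof (intro conjI)
  \<comment> \<open>At \<open>\<sigma>hat = \<sigma>\<close> membership in the simplex is the
    assumption on \<open>\<sigma>\<close>.\<close>
  show i_ii: "(\<exists>r v. fixed_point_kkt F \<sigma> \<mu> \<sigma> r v)
    \<longleftrightarrow> (\<exists>\<sigma>hat r v. (\<sigma>hat, r, v) = brouwer_function F \<sigma> \<mu> \<and> \<sigma> = \<sigma>hat)"
    unfolding brouwer_function_eq_iff[OF assms(3)] using assms(2) by blast
  have "(\<exists>r v. fixed_point_kkt F \<sigma> \<mu> \<sigma> r v) \<longleftrightarrow>
    (\<exists>r v lbar rchk ltilde.
      mcp_perturbed_kkt F (jacobian G (at \<sigma>)) \<sigma> \<mu> r v lbar \<sigma> rchk ltilde)"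
    by (simp only: mcp_perturbed_kkt_self_iff)
  also have "\<dots> \<longleftrightarrow> (\<exists>r lbar \<sigma>chk rchk v ltilde. \<sigma>chk = \<sigma> \<and>
      mcp_perturbed_kkt F (jacobian G (at \<sigma>)) \<sigma> \<mu> r v lbar \<sigma>chk rchk ltilde)"
    by blast
  finally show "(\<exists>\<sigma>hat r v. (\<sigma>hat, r, v) = brouwer_function F \<sigma> \<mu> \<and> \<sigma> = \<sigma>hat) \<longleftrightarrow> \<dots>"
    unfolding i_ii .
qed

end
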